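(* Every ordinary permutation matrix $P$ satisfies $\operatorname{sat}(n,P)=O(1)$, i.e. there is a constant $c_P$ such that $\operatorname{sat}(n,P)\le c_P$ for all $n$.
   Context: A 0-1 matrix $A$ contains a 0-1 matrix $P$ if some submatrix of $A$ (obtained by selecting a subset of rows and a subset of columns, keeping their order) is equal to $P$ or can be turned into $P$ by changing some ones to zeroes; otherwise $A$ avoids $P$. $A$ is saturating for $P$ if $A$ avoids $P$ but changing any zero of $A$ to a one creates a copy of $P$. $\operatorname{sat}(n,P)$ is the minimum number of ones in an $n\times n$ 0-1 matrix saturating for $P$. Say $P$ reduces to a class if some matrix obtainable from $P$ by a sequence of vertical/horizontal reflections and $90$-degree rotations lies in that class. A permutation matrix is ordinary if it reduces to none of the following four classes. Throughout, "splitting the rows into contiguous nonempty sets $R_1,R_2,\dots$" means the rows of $R_1$ precede those of $R_2$, etc., and similarly for columns. Class 1: permutation matrices $P$ whose rows split into contiguous nonempty $R_1,R_2$ and columns into contiguous nonempty $C_1,C_2$ such that $P$ has ones in $R_1\times C_1$ and in $R_2\times C_2$, and all ones of $P$ lie in these two submatrices except for at most $2$ ones in $R_1\times C_2$; if there are two ones in $R_1\times C_2$, they are in adjacent rows. Class 2: permutation matrices $P$ whose rows split into contiguous nonempty $R_1,R_2,R_3$ and columns into contiguous nonempty $C_1,C_2$ such that $P$ has ones in $R_1\times C_2$ and in $R_3\times C_2$, at least two ones in $R_2\times C_1$, and all ones of $P$ lie in these three submatrices except for at most $2$ ones in $R_2\times C_2$; if there are two ones in $R_2\times C_2$, they are in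 adjacent rows. Class 3: permutation matrices obtained from some element $X$ of Class 2 (with its sets $R_1,R_2,R_3,C_1,C_2$) by taking the row $r$ of $X$ containing the rightmost one in $R_2\times C_1$, deleting $r$ from its position, and inserting it above the first row of $X$. Class 4: permutation matrices $P$ whose rows split into contiguous nonempty $R_1,R_2,R_3$ and columns into contiguous nonempty $C_1,C_2,C_3$ such that $P$ has ones in each of $R_1\times C_2$, $R_2\times C_1$, $R_2\times C_3$, $R_3\times C_2$, and only in these submatrices. *)

theory Defs
  imports Main
begin

text \<open>A 0-1 matrix of size m x n is represented by the set of positions of its ones,
  a subset of {..<m} x {..<n} (rows and columns indexed from 0, row 0 on top).\<close>

definition perm_mat :: "nat \<Rightarrow> (nat \<times> nat) set \<Rightarrow> bool" where
  "perm_mat k P \<longleftrightarrow> P \<subseteq> {..<k} \<times> {..<k}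
     \<and> (\<forall>i<k. \<exists>!j. (i, j) \<in> P) \<and> (\<forall>j<k. \<exists>!i. (i, j) \<in> P)"

definition contains :: "nat \<Rightarrow> nat \<Rightarrow> (nat \<times> nat) set \<Rightarrow> nat \<Rightarrow> nat \<Rightarrow> (nat \<times> nat) set \<Rightarrow> bool" where
  "contains m n A k l P \<longleftrightarrow> (\<exists>f g.
      (\<forall>i j. i < j \<and> j < k \<longrightarrow> f i < f j) \<and> (\<forall>i<k. f i < m) \<and>
      (\<forall>i j. i < j \<and> j < l \<longrightarrow> g i < g j) \<and> (\<forall>j<l. g j < n) \<and>
      (\<forall>(i, j) \<in> P. (f i, g j) \<in> A))"

definition saturating :: "nat \<Rightarrow> (nat \<times> nat) set \<Rightarrow> nat \<Rightarrow> (nat \<times> nat) set \<Rightarrow> bool" where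
  "saturating n A k P \<longleftrightarrow> A \<subseteq> {..<n} \<times> {..<n} \<and> \<not> contains n n A k k P \<and>
     (\<forall>x \<in> ({..<n} \<times> {..<n}) - A. contains n n (insert x A) k k P)"

definition sat :: "nat \<Rightarrow> nat \<Rightarrow> (nat \<times> nat) set \<Rightarrow> nat" where
  "sat n k P = (LEAST c. \<exists>A. saturating n A k P \<and> card A = c)"

inductive_set sym_images :: "nat \<Rightarrow> (nat \<times> nat) set \<Rightarrow> (nat \<times> nat) set set"
  for k :: nat and P :: "(nat \<times> nat) set" where
  base: "P \<in> sym_images k P"
| vrefl: "Q \<in> sym_images k P \<Longrightarrow> (\<lambda>(i, j). (i, k - 1 - j)) ` Q \<in> sym_images k P"
| hrefl: "Q \<in> sym_images k P \<Longrightarrow> (\<lambda>(i, j). (k - 1 - i, j)) ` Q \<in> sym_images k P"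
| rot: "Q \<in> sym_images k P \<Longrightarrow> (\<lambda>(i, j). (j, k - 1 - i)) ` Q \<in> sym_images k P"

definition adj_rows_if_two :: "(nat \<times> nat) set \<Rightarrow> bool" where
  "adj_rows_if_two S \<longleftrightarrow> card S \<le> 2 \<and>
     (card S = 2 \<longrightarrow> (\<exists>r c r' c'. S = {(r, c), (r', c')} \<and> r' = r + 1))"

definition class1 :: "nat \<Rightarrow> (nat \<times> nat) set \<Rightarrow> bool" where
  "class1 k P \<longleftrightarrow> perm_mat k P \<and> (\<exists>a b. 0 < a \<and> a < k \<and> 0 < b \<and> b < k \<and>
     (let R1 = {..<a}; R2 = {a..<k}; C1 = {..<b}; C2 = {b..<k} in
       P \<inter> (R1 \<times> C1) \<noteq> {} \<and> P \<inter> (R2 \<times> C2) \<noteq> {} \<and>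
       P - ((R1 \<times> C1) \<union> (R2 \<times> C2)) \<subseteq> R1 \<times> C2 \<and>
       adj_rows_if_two (P \<inter> (R1 \<times> C2))))"

definition class2_wit :: "nat \<Rightarrow> (nat \<times> nat) set \<Rightarrow> nat \<Rightarrow> nat \<Rightarrow> nat \<Rightarrow> bool" where
  "class2_wit k P a1 a2 b \<longleftrightarrow> perm_mat k P \<and> 0 < a1 \<and> a1 < a2 \<and> a2 < k \<and> 0 < b \<and> b < k \<and>
     (let R1 = {..<a1}; R2 = {a1..<a2}; R3 = {a2..<k}; C1 = {..<b}; C2 = {b..<k} in
       P \<inter> (R1 \<times> C2) \<noteq> {} \<and> P \<inter> (R3 \<times> C2) \<noteq> {} \<and> card (P \<inter> (R2 \<times> C1)) \<ge> 2 \<and>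
       P - ((R1 \<times> C2) \<union> (R2 \<times> C1) \<union> (R3 \<times> C2)) \<subseteq> R2 \<times> C2 \<and>
       adj_rows_if_two (P \<inter> (R2 \<times> C2)))"

definition class2 :: "nat \<Rightarrow> (nat \<times> nat) set \<Rightarrow> bool" where
  "class2 k P \<longleftrightarrow> (\<exists>a1 a2 b. class2_wit k P a1 a2 b)"

definition move_row_top :: "nat \<Rightarrow> (nat \<times> nat) set \<Rightarrow> (nat \<times> nat) set" where
  "move_row_top r P = (\<lambda>(i, j). (if i = r then 0 else if i < r then i + 1 else i, j)) ` P"

definition class3 :: "nat \<Rightarrow> (nat \<times> nat) set \<Rightarrow> bool" where
  "class3 k Y \<longleftrightarrow> (\<exists>X a1 a2 b r c. class2_wit k X a1 a2 b \<and>
     (r, c) \<in> X \<inter> ({a1..<a2} \<times> {..<b}) \<and>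
     (\<forall>(i, j) \<in> X \<inter> ({a1..<a2} \<times> {..<b}). j \<le> c) \<and>
     Y = move_row_top r X)"

definition class4 :: "nat \<Rightarrow> (nat \<times> nat) set \<Rightarrow> bool" where
  "class4 k P \<longleftrightarrow> perm_mat k P \<and> (\<exists>a1 a2 b1 b2. 0 < a1 \<and> a1 < a2 \<and> a2 < k \<and>
     0 < b1 \<and> b1 < b2 \<and> b2 < k \<and>
     (let R1 = {..<a1}; R2 = {a1..<a2}; R3 = {a2..<k};
          C1 = {..<b1}; C2 = {b1..<b2}; C3 = {b2..<k} in
       P \<inter> (R1 \<times> C2) \<noteq> {} \<and> P \<inter> (R2 \<times> C1) \<noteq> {} \<and> P \<inter> (R2 \<times> C3) \<noteq> {} \<and>
       P \<inter> (R3 \<times> C2) \<noteq> {} \<and>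
       P \<subseteq> (R1 \<times> C2) \<union> (R2 \<times> C1) \<union> (R2 \<times> C3) \<union> (R3 \<times> C2)))"

definition ordinary :: "nat \<Rightarrow> (nat \<times> nat) set \<Rightarrow> bool" where
  "ordinary k P \<longleftrightarrow> perm_mat k P \<and>
     \<not> (\<exists>Q \<in> sym_images k P. class1 k Q \<or> class2 k Q \<or> class3 k Q \<or> class4 k Q)"

end

theory Submission
  imports Defs
begin

text \<open>
  Let \<open>q\<close> be the row of the rightmost one of \<open>P\<close> and \<open>p\<close> the row of its leftmost one. Put a copy \<open>A\<close>
  of \<open>P\<close> without its rightmost one to the left of a copy \<open>B\<close> of \<open>P\<close> without its leftmost one, so
  that the row \<open>q\<close> of \<open>A\<close> and the row \<open>p\<close> of \<open>B\<close> form the same empty row \<open>r\<close>. A one placed anywhere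
  in row \<open>r\<close> is to the right of \<open>A\<close> or to the left of \<open>B\<close> and so completes a copy of \<open>P\<close>. Let \<open>A\<close> and
  \<open>B\<close> share the two rows next to \<open>r\<close>, and let the other rows of \<open>B\<close> lie between these and the other
  rows of \<open>A\<close>. A copy of \<open>P\<close> in \<open>A \<union> B\<close> cuts \<open>P\<close> into a part in \<open>A\<close> and a part in \<open>B\<close>, which puts a
  reflection of \<open>P\<close> into Class 1 or Class 2.

  Such a matrix and its transposed analogue, placed diagonally, still avoid \<open>P\<close> because \<open>P\<close> is not a
  direct sum (Class 1). The empty row and the empty column can then be repeated to reach size \<open>n\<close>,
  and every saturating matrix above the result has no ones in the repeated rows and columns.
\<close>

section \<open>Permutation matrices and their symmetries\<close>

lemma perm_mat_bound: "perm_mat k P \<Longrightarrow> (i, j) \<in> P \<Longrightarrow> i < k \<and> j < k"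
  by (auto simp: perm_mat_def)

lemma perm_mat_row_unique: "perm_mat k P \<Longrightarrow> (i, j) \<in> P \<Longrightarrow> (i, j') \<in> P \<Longrightarrow> j = j'"
  unfolding perm_mat_def by blast

lemma perm_mat_col_unique: "perm_mat k P \<Longrightarrow> (i, j) \<in> P \<Longrightarrow> (i', j) \<in> P \<Longrightarrow> i = i'"
  unfolding perm_mat_def by blast

lemma perm_mat_row_ex: "perm_mat k P \<Longrightarrow> i < k \<Longrightarrow> \<exists>j. (i, j) \<in> P"
  by (meson perm_mat_def)

lemma perm_mat_col_ex: "perm_mat k P \<Longrightarrow> j < k \<Longrightarrow> \<exists>i. (i, j) \<in> P"
  by (meson perm_mat_def)

lemma perm_matI:
  assumes "\<And>i j. (i, j) \<in> P \<Longrightarrow> i < k \<and> j < k"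
    and "\<And>i. i < k \<Longrightarrow> \<exists>j. (i, j) \<in> P" "\<And>j. j < k \<Longrightarrow> \<exists>i. (i, j) \<in> P"
    and "\<And>i j j'. (i, j) \<in> P \<Longrightarrow> (i, j') \<in> P \<Longrightarrow> j = j'"
    and "\<And>i i' j. (i, j) \<in> P \<Longrightarrow> (i', j) \<in> P \<Longrightarrow> i = i'"
  shows "perm_mat k P"
proof -
  have "\<exists>!j. (i, j) \<in> P" if "i < k" for i using assms(2)[OF that] assms(4) by blast
  moreover have "\<exists>!i. (i, j) \<in> P" if "j < k" for j using assms(3)[OF that] assms(5) by blast
  ultimately show ?thesis using assms(1) unfolding perm_mat_def by auto
qed

lemma perm_mat_finite: "perm_mat k P \<Longrightarrow> finite P"
  unfolding perm_mat_def by (meson finite_SigmaI finite_lessThan finite_subset)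

section \<open>Reflections and transposition\<close>

definition vflip :: "nat \<Rightarrow> (nat \<times> nat) set \<Rightarrow> (nat \<times> nat) set" where
  "vflip k P = (\<lambda>(i, j). (i, k - 1 - j)) ` P"

definition hflip :: "nat \<Rightarrow> (nat \<times> nat) set \<Rightarrow> (nat \<times> nat) set" where
  "hflip k P = (\<lambda>(i, j). (k - 1 - i, j)) ` P"

definition flip_diag :: "(nat \<times> nat) set \<Rightarrow> (nat \<times> nat) set" where
  "flip_diag P = {(j, i). (i, j) \<in> P}"

lemma vflip_iff: "perm_mat k P \<Longrightarrow> (i, j) \<in> vflip k P \<longleftrightarrow> j < k \<and> (i, k - 1 - j) \<in> P"
  unfolding vflip_def by (force dest: perm_mat_bound)

lemma hflip_iff: "perm_mat k P \<Longrightarrow> (i, j) \<in> hflip k P \<longleftrightarrow> i < k \<and> (k - 1 - i, j) \<in> P"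
  unfolding hflip_def by (force dest: perm_mat_bound)

lemma flip_diag_iff [simp]: "(i, j) \<in> flip_diag P \<longleftrightarrow> (j, i) \<in> P"
  by (simp add: flip_diag_def)

lemma perm_mat_flip_diag: "perm_mat k P \<Longrightarrow> perm_mat k (flip_diag P)"
  by (rule perm_matI)
    (auto dest: perm_mat_bound perm_mat_row_ex perm_mat_col_ex perm_mat_row_unique perm_mat_col_unique)

lemma perm_mat_vflip:
  assumes P: "perm_mat k P"
  shows "perm_mat k (vflip k P)"
proof (rule perm_matI)
  fix i j assume "(i, j) \<in> vflip k P"
  then show "i < k \<and> j < k" by (auto simp: vflip_iff[OF P] dest: perm_mat_bound[OF P])
next
  fix i assume "i < k"
  then obtain j where "(i, j) \<in> P" using perm_mat_row_ex[OF P] by blast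
  then have "(i, k - 1 - j) \<in> vflip k P"
    using perm_mat_bound[OF P] by (force simp: vflip_iff[OF P])
  then show "\<exists>j. (i, j) \<in> vflip k P" ..
next
  fix j assume "j < k"
  then show "\<exists>i. (i, j) \<in> vflip k P"
    using perm_mat_col_ex[OF P, of "k - 1 - j"] by (auto simp: vflip_iff[OF P])
next
  fix i j j' assume *: "(i, j) \<in> vflip k P" "(i, j') \<in> vflip k P"
  then have "k - 1 - j = k - 1 - j'" using perm_mat_row_unique[OF P] by (auto simp: vflip_iff[OF P])
  then show "j = j'" using * by (auto simp: vflip_iff[OF P])
next
  fix i i' j assume "(i, j) \<in> vflip k P" "(i', j) \<in> vflip k P"
  then show "i = i'" using perm_mat_col_unique[OF P] by (auto simp: vflip_iff[OF P])
qed

lemma hflip_eq: "hflip k P = flip_diag (vflip k (flip_diag P))"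
  unfolding hflip_def vflip_def flip_diag_def by force

lemma perm_mat_hflip: "perm_mat k P \<Longrightarrow> perm_mat k (hflip k P)"
  by (simp add: hflip_eq perm_mat_flip_diag perm_mat_vflip)

lemma vflip_sym: "Q \<in> sym_images k P \<Longrightarrow> vflip k Q \<in> sym_images k P"
  unfolding vflip_def by (rule sym_images.vrefl)

lemma hflip_sym: "Q \<in> sym_images k P \<Longrightarrow> hflip k Q \<in> sym_images k P"
  unfolding hflip_def by (rule sym_images.hrefl)

lemma sym_images_trans: "R \<in> sym_images k Q \<Longrightarrow> Q \<in> sym_images k P \<Longrightarrow> R \<in> sym_images k P"
  by (induction rule: sym_images.induct) (blast intro: sym_images.intros)+

text \<open>A quarter turn followed by \<open>vrefl\<close> is transposition, so the construction
  made for rows also serves for columns.\<close>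

lemma flip_diag_sym:
  assumes "perm_mat k P"
  shows "flip_diag P \<in> sym_images k P"
proof -
  have "flip_diag P = (\<lambda>(i, j). (i, k - 1 - j)) ` (\<lambda>(i, j). (j, k - 1 - i)) ` P"
    unfolding flip_diag_def image_image
    by (rule set_eqI) (use perm_mat_bound[OF assms] in \<open>force simp: image_iff split_beta\<close>)
  moreover have "\<dots> \<in> sym_images k P" by (intro sym_images.intros)
  ultimately show ?thesis by simp
qed

lemma ordinary_flip_diag: "ordinary k P \<Longrightarrow> ordinary k (flip_diag P)"
  unfolding ordinary_def using flip_diag_sym sym_images_trans perm_mat_flip_diag by blast

section \<open>Excluded decompositions\<close>

definition adjacent_rows :: "(nat \<times> nat) set \<Rightarrow> bool" where
  "adjacent_rows S \<longleftrightarrow> (\<forall>i j i' j'. (i, j) \<in> S \<longrightarrow> (i', j') \<in> S \<longrightarrow> i < i' \<longrightarrow> i' = Suc i)"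

text \<open>Three rows cannot be pairwise consecutive, and \<open>S\<close> has at most one element
  per row, so adjacency alone bounds \<open>card S\<close> by 2.\<close>

lemma adj_rows_if_twoI:
  assumes P: "perm_mat k P" and S: "S \<subseteq> P" and adj: "adjacent_rows S"
  shows "adj_rows_if_two S"
proof (cases "\<exists>i j i' j'. (i, j) \<in> S \<and> (i', j') \<in> S \<and> i < i'")
  case True
  then obtain i j i' j' where ij: "(i, j) \<in> S" "(i', j') \<in> S" "i < i'" by blast
  have i': "i' = Suc i" using adj ij unfolding adjacent_rows_def by blast
  have "S \<subseteq> {(i, j), (i', j')}"
  proof
    fix x assume x: "x \<in> S"
    obtain a b where ab: "x = (a, b)" by (cases x)
    have "a = i \<or> a = i'"
    proof (rule ccontr)
      assume "\<not> ?thesis"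
      then consider "a < i" | "i' < a" using i' by linarith
      then show False
      proof cases
        case 1
        then have "i = Suc a" "i' = Suc a"
          using adj x ij ab unfolding adjacent_rows_def by (blast, meson less_trans)
        then show False using i' by simp
      next
        case 2
        then have "a = Suc i" 
          using adj x ij ab unfolding adjacent_rows_def by (meson less_trans)
        then show False using i' 2 by simp
      qed
    qed
    then show "x \<in> {(i, j), (i', j')}" using ab x S ij perm_mat_row_unique[OF P] by blast
  qed
  then have "S = {(i, j), (i', j')}" using ij by blast
  then show ?thesis unfolding adj_rows_if_two_def using i' by (auto simp: card_insert_if)
next
  case False
  have "card S \<le> 1"
  proof (rule ccontr)
    assume "\<not> card S \<le> 1"
    then obtain x y where "x \<in> S" "y \<in> S" "x \<noteq> y"
      by (metis card_1_singleton_iff card_le_Suc0_iff_eq card.infinite le0 One_nat_def)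
    then show False using False S perm_mat_row_unique[OF P]
      by (metis linorder_neq_iff subsetD surj_pair)
  qed
  then show ?thesis unfolding adj_rows_if_two_def by auto
qed

text \<open>The nonempty blocks come for free: the one of column 0 cannot lie in a row from
  \<open>a\<close> on, and the one of the last row must lie in a column from \<open>b\<close>
  on.\<close>

lemma class1I:
  assumes P: "perm_mat k P" and "0 < a" "a < k" "0 < b" "b < k"
    and no: "\<And>i j. (i, j) \<in> P \<Longrightarrow> a \<le> i \<Longrightarrow> b \<le> j"
    and adj: "adjacent_rows (P \<inter> {..<a} \<times> {b..<k})"
  shows "class1 k P"
proof -
  obtain i where i: "(i, 0) \<in> P" using perm_mat_col_ex[OF P] assms(1-5) by fastforce
  have "\<not> a \<le> i" using no[OF i] \<open>0 < b\<close> by auto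
  with i have "(i, 0) \<in> P \<inter> {..<a} \<times> {..<b}" using \<open>0 < b\<close> by simp
  moreover obtain j where j: "(k - 1, j) \<in> P" using perm_mat_row_ex[OF P] assms(1-5) by fastforce
  then have "(k - 1, j) \<in> P \<inter> {a..<k} \<times> {b..<k}"
    using no[OF j] assms(1-5) perm_mat_bound[OF P j] by auto
  moreover have "P - (({..<a} \<times> {..<b}) \<union> ({a..<k} \<times> {b..<k})) \<subseteq> {..<a} \<times> {b..<k}"
    using no perm_mat_bound[OF P] by force
  moreover have "adj_rows_if_two (P \<inter> {..<a} \<times> {b..<k})"
    using adj_rows_if_twoI[OF P _ adj] by blast
  ultimately show ?thesis unfolding class1_def Let_def using assms(1-5) by blast
qed

text \<open>Nonemptiness is again automatic. Columns 0 and 1 supply the two ones required in the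
  left block, hence \<open>2 \<le> b\<close>; the first and last rows supply the outer
  blocks.\<close>

lemma class2I:
  assumes P: "perm_mat k P" and "0 < a1" "a1 < a2" "a2 < k" "2 \<le> b" "b < k"
    and no: "\<And>i j. (i, j) \<in> P \<Longrightarrow> i < a1 \<or> a2 \<le> i \<Longrightarrow> b \<le> j"
    and adj: "adjacent_rows (P \<inter> {a1..<a2} \<times> {b..<k})"
  shows "class2 k P"
proof -
  obtain i where i: "(i, 0) \<in> P" using perm_mat_col_ex[OF P] assms(1-6) by fastforce
  obtain i' where i': "(i', 1) \<in> P" using perm_mat_col_ex[OF P, of 1] assms(1-6) by auto
  have "\<not> (i < a1 \<or> a2 \<le> i)" "\<not> (i' < a1 \<or> a2 \<le> i')"
    using no[OF i] no[OF i'] \<open>2 \<le> b\<close> by auto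
  then have "{(i, 0), (i', 1)} \<subseteq> P \<inter> {a1..<a2} \<times> {..<b}"
    using i i' \<open>2 \<le> b\<close> by auto
  from card_mono[OF _ this] have "2 \<le> card (P \<inter> {a1..<a2} \<times> {..<b})"
    using perm_mat_finite[OF P] by auto
  moreover obtain j where j: "(0, j) \<in> P" using perm_mat_row_ex[OF P] assms(1-6) by fastforce
  then have "(0, j) \<in> P \<inter> {..<a1} \<times> {b..<k}"
    using no[OF j] assms(1-6) perm_mat_bound[OF P j] by auto
  moreover obtain j' where j': "(k - 1, j') \<in> P" using perm_mat_row_ex[OF P] assms(1-6) by fastforce
  moreover have "a2 \<le> k - 1" using \<open>a2 < k\<close> by linarith
  then have "(k - 1, j') \<in> P \<inter> {a2..<k} \<times> {b..<k}"
    using no[OF j'] j' perm_mat_bound[OF P j'] by auto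
  moreover have "P - (({..<a1} \<times> {b..<k}) \<union> ({a1..<a2} \<times> {..<b}) \<union> ({a2..<k} \<times> {b..<k}))
      \<subseteq> {a1..<a2} \<times> {b..<k}"
    using no perm_mat_bound[OF P] by force
  moreover have "adj_rows_if_two (P \<inter> {a1..<a2} \<times> {b..<k})"
    using adj_rows_if_twoI[OF P _ adj] by blast
  moreover have "0 < b" using \<open>2 \<le> b\<close> by simp
  ultimately have "class2_wit k P a1 a2 b" unfolding class2_wit_def Let_def
    using assms(1-6) by (intro conjI) blast+
  then show ?thesis unfolding class2_def by blast
qed

lemma ordinary_perm: "ordinary k P \<Longrightarrow> perm_mat k P"
  by (simp add: ordinary_def)

section \<open>Splits that an ordinary matrix cannot have\<close>

lemma adjacent_rows_vflip:
  assumes P: "perm_mat k P" and adj: "adjacent_rows (P \<inter> I \<times> {..<b})"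
  shows "adjacent_rows (vflip k P \<inter> I \<times> {k - b..<k})"
  unfolding adjacent_rows_def
proof (intro allI impI)
  fix i j i' j'
  assume "(i, j) \<in> vflip k P \<inter> I \<times> {k - b..<k}" "(i', j') \<in> vflip k P \<inter> I \<times> {k - b..<k}" "i < i'"
  then have "(i, k - 1 - j) \<in> P \<inter> I \<times> {..<b}" "(i', k - 1 - j') \<in> P \<inter> I \<times> {..<b}"
    by (auto simp: vflip_iff[OF P])
  then show "i' = Suc i" using adj \<open>i < i'\<close> unfolding adjacent_rows_def by blast
qed

text \<open>A direct sum is the case of Class 1 whose exceptional block is empty.\<close>

lemma ordinary_no_sum:
  assumes ord: "ordinary k P" and "0 < a" "a < k" "0 < b" "b < k"
    and "\<And>i j. (i, j) \<in> P \<Longrightarrow> i < a \<longleftrightarrow> j < b"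
  shows False
proof -
  have "class1 k P"
  proof (rule class1I[OF ordinary_perm[OF ord] assms(2-5)])
    show "b \<le> j" if "(i, j) \<in> P" "a \<le> i" for i j
      using assms(6)[OF that(1)] that(2) by linarith
    show "adjacent_rows (P \<inter> {..<a} \<times> {b..<k})"
      using assms(6) by (fastforce simp: adjacent_rows_def)
  qed
  then show False using ord sym_images.base unfolding ordinary_def by blast
qed

text \<open>The left-right mirror image is in Class 1, with \<open>{..<a} \<times> {..<b}\<close>
  becoming the exceptional block.\<close>

lemma ordinary_no_split_top:
  assumes ord: "ordinary k P" and "0 < a" "a < k" "0 < b" "b < k"
    and no: "\<And>i j. (i, j) \<in> P \<Longrightarrow> a \<le> i \<Longrightarrow> j < b"
    and adj: "adjacent_rows (P \<inter> {..<a} \<times> {..<b})"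
  shows False
proof -
  note P = ordinary_perm[OF ord]
  have "class1 k (vflip k P)"
  proof (rule class1I[OF perm_mat_vflip[OF P], of a "k - b"])
    show "adjacent_rows (vflip k P \<inter> {..<a} \<times> {k - b..<k})"
      by (rule adjacent_rows_vflip[OF P adj])
    fix i j assume "(i, j) \<in> vflip k P" "a \<le> i"
    then show "k - b \<le> j" using no[of i "k - 1 - j"] by (auto simp: vflip_iff[OF P])
  qed (use assms in auto)
  then show False using ord vflip_sym[OF sym_images.base] unfolding ordinary_def by blast
qed

lemma ordinary_hflip: "ordinary k P \<Longrightarrow> ordinary k (hflip k P)"
  unfolding ordinary_def using hflip_sym[OF sym_images.base] sym_images_trans perm_mat_hflip by blast

text \<open>Turning the matrix upside down reduces this to the split at the top; consecutive rows
  stay consecutive.\<close>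

lemma ordinary_no_split_bottom:
  assumes ord: "ordinary k P" and "0 < a" "a < k" "0 < b" "b < k"
    and no: "\<And>i j. (i, j) \<in> P \<Longrightarrow> i < a \<Longrightarrow> j < b"
    and adj: "adjacent_rows (P \<inter> {a..<k} \<times> {..<b})"
  shows False
proof (rule ordinary_no_split_top[OF ordinary_hflip[OF ord], of "k - a" b])
  note P = ordinary_perm[OF ord]
  show "adjacent_rows (hflip k P \<inter> {..<k - a} \<times> {..<b})"
    unfolding adjacent_rows_def
  proof (intro allI impI)
    fix i j i' j'
    assume *: "(i, j) \<in> hflip k P \<inter> {..<k - a} \<times> {..<b}"
      "(i', j') \<in> hflip k P \<inter> {..<k - a} \<times> {..<b}" "i < i'"
    then have "(k - 1 - i, j) \<in> P \<inter> {a..<k} \<times> {..<b}" "(k - 1 - i', j') \<in> P \<inter> {a..<k} \<times> {..<b}"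
      by (auto simp: hflip_iff[OF P])
    moreover have "k - 1 - i' < k - 1 - i" using * by auto
    ultimately have "k - 1 - i = Suc (k - 1 - i')" using adj unfolding adjacent_rows_def by blast
    then show "i' = Suc i" using * by auto
  qed
  fix i j assume "(i, j) \<in> hflip k P" "k - a \<le> i"
  then show "j < b" using no[of "k - 1 - i" j] by (auto simp: hflip_iff[OF P])
qed (use assms in auto)

text \<open>The left-right mirror image is in Class 2. The columns from \<open>b\<close> on become
  its left part, which needs two ones, hence \<open>b + 2 \<le> k\<close>.\<close>

lemma ordinary_no_split_middle:
  assumes ord: "ordinary k P" and "0 < a1" "a1 < a2" "a2 < k" "0 < b" "b + 2 \<le> k"
    and no: "\<And>i j. (i, j) \<in> P \<Longrightarrow> i < a1 \<or> a2 \<le> i \<Longrightarrow> j < b"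
    and adj: "adjacent_rows (P \<inter> {a1..<a2} \<times> {..<b})"
  shows False
proof -
  note P = ordinary_perm[OF ord]
  have "class2 k (vflip k P)"
  proof (rule class2I[OF perm_mat_vflip[OF P], of a1 a2 "k - b"])
    show "adjacent_rows (vflip k P \<inter> {a1..<a2} \<times> {k - b..<k})"
      by (rule adjacent_rows_vflip[OF P adj])
    fix i j assume "(i, j) \<in> vflip k P" "i < a1 \<or> a2 \<le> i"
    then show "k - b \<le> j" using no[of i "k - 1 - j"] by (auto simp: vflip_iff[OF P])
  qed (use assms in auto)
  then show False using ord vflip_sym[OF sym_images.base] unfolding ordinary_def by blast
qed

section \<open>Occurrences of a pattern\<close>

text \<open>Containment without the size of the host matrix, so that blocks can be placed
  freely.\<close>

definition occurs :: "nat \<Rightarrow> (nat \<times> nat) set \<Rightarrow> (nat \<times> nat) set \<Rightarrow> bool" where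
  "occurs k P A \<longleftrightarrow> (\<exists>f g. strict_mono_on {..<k} f \<and> strict_mono_on {..<k} g \<and>
     (\<forall>(i, j) \<in> P. (f i, g j) \<in> A))"

lemma occursI:
  assumes "\<And>i j. i < j \<Longrightarrow> j < k \<Longrightarrow> f i < f j" "\<And>i j. i < j \<Longrightarrow> j < k \<Longrightarrow> g i < g j"
    and "\<And>i j. (i, j) \<in> P \<Longrightarrow> (f i, g j) \<in> A"
  shows "occurs k P A"
  unfolding occurs_def using assms by (intro exI[of _ f] exI[of _ g]) (auto simp: strict_mono_on_def)

lemma occursE:
  assumes "occurs k P A"
  obtains f g where "\<And>i j. i < j \<Longrightarrow> j < k \<Longrightarrow> f i < f j" "\<And>i j. i < j \<Longrightarrow> j < k \<Longrightarrow> g i < g j"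
    and "\<And>i j. (i, j) \<in> P \<Longrightarrow> (f i, g j) \<in> A"
proof -
  obtain f g where fg: "strict_mono_on {..<k} f" "strict_mono_on {..<k} g"
    "\<And>i j. (i, j) \<in> P \<Longrightarrow> (f i, g j) \<in> A"
    using assms unfolding occurs_def by blast
  show ?thesis by (rule that[OF _ _ fg(3)]) (use fg(1,2) in \<open>auto simp: strict_mono_on_def\<close>)
qed

lemma occurs_mono: "occurs k P A \<Longrightarrow> A \<subseteq> B \<Longrightarrow> occurs k P B"
  unfolding occurs_def by blast

lemma occurs_flip_diag: "occurs k (flip_diag P) (flip_diag A) \<longleftrightarrow> occurs k P A"
  unfolding occurs_def flip_diag_def by fast

text \<open>Every row and column of \<open>P\<close> holds a one, whose image in \<open>A\<close>
  bounds \<open>f\<close> and \<open>g\<close>.\<close>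

lemma contains_iff_occurs:
  assumes P: "perm_mat k P" and A: "A \<subseteq> {..<n} \<times> {..<n}"
  shows "contains n n A k k P \<longleftrightarrow> occurs k P A"
proof
  assume "contains n n A k k P"
  then obtain f g where "\<forall>i j. i < j \<and> j < k \<longrightarrow> f i < f j" "\<forall>i j. i < j \<and> j < k \<longrightarrow> g i < g j"
    "\<forall>(i, j) \<in> P. (f i, g j) \<in> A" unfolding contains_def by blast
  then show "occurs k P A" by (intro occursI[of k f g]) auto
next
  assume "occurs k P A"
  then obtain f g where fg: "\<And>i j. i < j \<Longrightarrow> j < k \<Longrightarrow> f i < f j" "\<And>i j. i < j \<Longrightarrow> j < k \<Longrightarrow> g i < g j"
    "\<And>i j. (i, j) \<in> P \<Longrightarrow> (f i, g j) \<in> A" by (rule occursE) blast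
  have "f i < n" if "i < k" for i using perm_mat_row_ex[OF P that] fg(3) A by blast
  moreover have "g j < n" if "j < k" for j using perm_mat_col_ex[OF P that] fg(3) A by blast
  ultimately show "contains n n A k k P"
    unfolding contains_def using fg by (intro exI[of _ f] exI[of _ g]) auto
qed

text \<open>Strictly increasing values that fill an interval leave no gap: induction from the left
  bounds \<open>f i\<close> below, induction from the right end bounds it above.\<close>

lemma strict_mono_prefix:
  fixes f :: "nat \<Rightarrow> nat"
  assumes "\<And>i j. i < j \<Longrightarrow> j < k \<Longrightarrow> f i < f j"
    and "\<And>i. i < k \<Longrightarrow> u \<le> f i \<and> f i < u + k" and "i < k"
  shows "f i = u + i"
proof -
  have "u + i \<le> f i" using \<open>i < k\<close>
  proof (induction i)
    case 0
    then show ?case using assms(2) by simp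
  next
    case (Suc i)
    have "f i < f (Suc i)" using Suc.prems by (intro assms(1)) auto
    then show ?case using Suc by simp
  qed
  moreover have "f (k - Suc m) + m < u + k" if "m < k" for m
    using that
  proof (induction m)
    case 0
    then show ?case using assms(2)[of "k - 1"] by simp
  next
    case (Suc m)
    have "f (k - Suc (Suc m)) < f (k - Suc m)" using Suc.prems by (intro assms(1)) auto
    then show ?case using Suc by simp
  qed
  from this[of "k - Suc i"] have "f i + (k - Suc i) < u + k"
    using \<open>i < k\<close> by simp
  ultimately show ?thesis using \<open>i < k\<close> by linarith
qed

text \<open>The cut that a copy of the pattern makes at coordinate \<open>u\<close>; the values 0
  and \<open>k\<close> of \<open>a\<close> cover copies lying on one side.\<close>

lemma mono_threshold:
  fixes f :: "nat \<Rightarrow> nat"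
  assumes "\<And>i j. i < j \<Longrightarrow> j < k \<Longrightarrow> f i < f j"
  shows "\<exists>a\<le>k. \<forall>i<k. f i < u \<longleftrightarrow> i < a"
proof -
  define a where "a = (LEAST a. a = k \<or> u \<le> f a)"
  have a: "a = k \<or> u \<le> f a" unfolding a_def by (rule LeastI[of _ k]) simp
  have lt: "i \<noteq> k \<and> f i < u" if "i < a" for i
    using not_less_Least[of i "\<lambda>a. a = k \<or> u \<le> f a"] that unfolding a_def by auto
  have "a \<le> k" unfolding a_def by (rule Least_le) simp
  moreover have "f i < u \<longleftrightarrow> i < a" if "i < k" for i
  proof (cases "i < a")
    case False
    then have "u \<le> f a" "f a \<le> f i" using a that assms[of a i] by (cases "a = i"; force)+
    then show ?thesis using False by simp
  qed (use lt in auto)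
  ultimately show ?thesis by blast
qed

section \<open>A matrix with an expandable row\<close>

text \<open>The offsets \<open>s\<close> and \<open>t\<close> only place the block. The new one may
  lie in any column \<open>y\<close>, even outside the block, as needed when blocks are
  combined.\<close>

lemma horizontal_witness:
  assumes ord: "ordinary k P" and k: "2 \<le> k"
  obtains H r where "H \<subseteq> {s..<s + 2 * k} \<times> {t..<t + 2 * k}" "s \<le> r" "r < s + 2 * k"
    "\<not> occurs k P H" "\<And>y. occurs k P (insert (r, y) H)"
proof -
  note P = ordinary_perm[OF ord]
  note bnd = perm_mat_bound[OF P]
  note rowu = perm_mat_row_unique[OF P]
  note colu = perm_mat_col_unique[OF P]
  obtain p where p: "(p, 0) \<in> P" using perm_mat_col_ex[OF P] k by fastforce
  obtain q where q: "(q, k - 1) \<in> P" using perm_mat_col_ex[OF P, of "k - 1"] k by auto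
  \<comment> \<open>Rows \<open>p\<close> and \<open>q\<close> need a neighbour on each side. A one
    in a corner would make \<open>P\<close>, possibly after reflection, a direct sum.\<close>
  have p0: "0 < p"
  proof (rule ccontr)
    assume "\<not> 0 < p"
    then show False using ordinary_no_sum[OF ord, of 1 1] p k rowu colu by fastforce
  qed
  have pk: "p < k - 1"
  proof (rule ccontr)
    assume "\<not> p < k - 1"
    then have "p = k - 1" using bnd[OF p] by linarith
    with p have p: "(k - 1, 0) \<in> P" by simp
    show False
    proof (rule ordinary_no_split_top[OF ord, of "k - 1" 1])
      fix i j assume ij: "(i, j) \<in> P" "k - 1 \<le> i"
      then have "i = k - 1" using bnd by fastforce
      then show "j < 1" using rowu[OF p] ij by auto
    next
      show "adjacent_rows (P \<inter> {..<k - 1} \<times> {..<1})"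
        using colu[OF p] by (auto simp: adjacent_rows_def)
    qed (use k in auto)
  qed
  have q0: "0 < q"
  proof (rule ccontr)
    assume "\<not> 0 < q"
    with q have q: "(0, k - 1) \<in> P" by simp
    show False
    proof (rule ordinary_no_split_top[OF ord, of 1 "k - 1"])
      fix i j assume ij: "(i, j) \<in> P" "1 \<le> i"
      then have "j \<noteq> k - 1" using colu[OF q] by auto
      then show "j < k - 1" using bnd[OF ij(1)] by auto
    next
      show "adjacent_rows (P \<inter> {..<1} \<times> {..<k - 1})"
        using rowu[OF q] by (auto simp: adjacent_rows_def)
    qed (use k in auto)
  qed
  have qk: "q < k - 1"
  proof (rule ccontr)
    assume "\<not> q < k - 1"
    then have "q = k - 1" using bnd[OF q] by linarith
    with q have q: "(k - 1, k - 1) \<in> P" by simp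
    show False
    proof (rule ordinary_no_sum[OF ord, of "k - 1" "k - 1"])
      fix i j assume ij: "(i, j) \<in> P"
      have "i = k - 1 \<longleftrightarrow> j = k - 1" using rowu[OF q] colu[OF q] ij by auto
      then show "i < k - 1 \<longleftrightarrow> j < k - 1" using bnd[OF ij] by linarith
    qed (use k in auto)
  qed
  obtain p' where p': "p = Suc p'" using p0 by (cases p) auto
  obtain q' where q': "q = Suc q'" using q0 by (cases q) auto
  \<comment> \<open>Rows \<open>q'\<close>, \<open>q\<close>, \<open>q + 1\<close> of
    \<open>A\<close> land on \<open>r - 1\<close>, \<open>r\<close>, \<open>r + 1\<close>. Earlier
    rows stay above the band \<open>{s + q'..<s + q' + k}\<close> that holds \<open>B\<close>, and
    the shift \<open>k - 3\<close> puts the later ones just below it.\<close>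
  define ra where "ra i = s + (if i < q' then i else if i \<le> q' + 2 then i + p' else i + (k - 3))" for i
  define rb where "rb i = s + q' + i" for i
  define r where "r = s + q' + p"
  define A where "A = {(ra i, t + j) |i j. (i, j) \<in> P \<and> j < k - 1}"
  \<comment> \<open>\<open>B\<close> starts with column 1 of \<open>P\<close>, so the offset
    \<open>k - 2\<close> puts it right after the last column \<open>t + (k - 2)\<close> of
    \<open>A\<close>.\<close>
  define B where "B = {(rb i, t + (k - 2) + j) |i j. (i, j) \<in> P \<and> 0 < j}"
  have lastcol: "i = q" if "(i, j) \<in> P" "\<not> j < k - 1" for i j
  proof -
    have "j = k - 1" using bnd[OF that(1)] that(2) by linarith
    then show ?thesis using colu[OF q] that by blast
  qed
  have Abnd: "x \<in> {s..<s + 2 * k} \<and> y \<in> {t..<t + (k - 1)}" if xy: "(x, y) \<in> A" for x y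
  proof -
    obtain i j where ij: "x = ra i" "y = t + j" "(i, j) \<in> P" "j < k - 1"
      using xy unfolding A_def by auto
    with bnd[OF ij(3)] show ?thesis unfolding ra_def using p' q' pk qk by auto
  qed
  have Bbnd: "x \<in> {s + q'..<s + q' + k} \<and> y \<in> {t + (k - 1)..<t + 2 * (k - 1)}" if xy: "(x, y) \<in> B" for x y
  proof -
    obtain i j where ij: "x = rb i" "y = t + (k - 2) + j" "(i, j) \<in> P" "0 < j"
      using xy unfolding B_def by auto
    with bnd[OF ij(3)] show ?thesis unfolding rb_def by auto
  qed
  have ra_mono: "ra i < ra j" if "i < j" for i j
    using that p' pk unfolding ra_def by auto
  have rb_mono: "rb i < rb j" if "i < j" for i j
    using that unfolding rb_def by auto
  have raq: "ra q = r" unfolding ra_def r_def using q' p' by simp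
  have rbp: "rb p = r" unfolding rb_def r_def by simp
  have notr: "x \<noteq> r" if "(x, y) \<in> A \<union> B" for x y
    using that
  proof
    assume "(x, y) \<in> A"
    then obtain i j where ij: "x = ra i" "(i, j) \<in> P" "j < k - 1" unfolding A_def by blast
    then have "i \<noteq> q" using rowu[OF q] by blast
    then show ?thesis using ij raq ra_mono by (metis linorder_neq_iff)
  next
    assume "(x, y) \<in> B"
    then obtain i j where ij: "x = rb i" "(i, j) \<in> P" "0 < j" unfolding B_def by blast
    then have "i \<noteq> p" using rowu[OF p] by blast
    then show ?thesis using ij rbp rb_mono by (metis linorder_neq_iff)
  qed
  show ?thesis
  proof (rule that[of "A \<union> B" r])
    show "A \<union> B \<subseteq> {s..<s + 2 * k} \<times> {t..<t + 2 * k}"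
      using q' qk by (auto dest!: Abnd Bbnd)
    show "s \<le> r" "r < s + 2 * k" unfolding r_def using pk qk q' by auto
  next
    fix y
    show "occurs k P (insert (r, y) (A \<union> B))"
    proof (cases "t + (k - 1) \<le> y")
      case True
      show ?thesis
      proof (rule occursI[where f = ra and g = "\<lambda>j. if j < k - 1 then t + j else y"])
        fix i j assume ij: "(i, j) \<in> P"
        show "(ra i, if j < k - 1 then t + j else y) \<in> insert (r, y) (A \<union> B)"
        proof (cases "j < k - 1")
          case False
          then have "i = q" using lastcol ij by blast
          then show ?thesis using False raq by simp
        qed (use ij in \<open>auto simp: A_def\<close>)
      qed (use ra_mono True in auto)
    next
      case False
      show ?thesis
      proof (rule occursI[where f = rb and g = "\<lambda>j. if j = 0 then y else t + (k - 2) + j"])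
        fix i j assume ij: "(i, j) \<in> P"
        show "(rb i, if j = 0 then y else t + (k - 2) + j) \<in> insert (r, y) (A \<union> B)"
        proof (cases "j = 0")
          case True
          then have "i = p" using ij colu[OF p] by metis
          then show ?thesis using True rbp by simp
        qed (use ij in \<open>auto simp: B_def\<close>)
      qed (use rb_mono False in auto)
    qed
  next
    show "\<not> occurs k P (A \<union> B)"
    proof
      assume "occurs k P (A \<union> B)"
      then obtain f g where f: "\<And>i j. i < j \<Longrightarrow> j < k \<Longrightarrow> f i < f j"
        and g: "\<And>i j. i < j \<Longrightarrow> j < k \<Longrightarrow> g i < g j"
        and fg: "\<And>i j. (i, j) \<in> P \<Longrightarrow> (f i, g j) \<in> A \<union> B" by (rule occursE) blast
      have fr: "f i \<noteq> r" if "i < k" for i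
        using perm_mat_row_ex[OF P that] fg notr by blast
      have gbnd: "t \<le> g j \<and> g j < t + 2 * (k - 1)" if j: "j < k" for j
      proof -
        obtain i where "(i, j) \<in> P" using perm_mat_col_ex[OF P j] ..
        from fg[OF this] show ?thesis by (auto dest!: Abnd Bbnd)
      qed
      \<comment> \<open>\<open>b\<close> separates the columns of the copy in \<open>A\<close> from
        those in \<open>B\<close>; \<open>a1\<close> and \<open>a2\<close> separate the rows sent
        above, into and below the band of \<open>B\<close>.\<close>
      obtain b where bk: "b \<le> k" and b: "\<And>j. j < k \<Longrightarrow> g j < t + (k - 1) \<longleftrightarrow> j < b"
        using mono_threshold[of k g "t + (k - 1)"] g by blast
      obtain a1 where a1: "a1 \<le> k" "\<And>i. i < k \<Longrightarrow> f i < s + q' \<longleftrightarrow> i < a1"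
        using mono_threshold[of k f "s + q'"] f by blast
      obtain a2 where a2: "a2 \<le> k" "\<And>i. i < k \<Longrightarrow> f i < s + q' + k \<longleftrightarrow> i < a2"
        using mono_threshold[of k f "s + q' + k"] f by blast
      have inA: "(f i, g j) \<in> A" if "(i, j) \<in> P" "j < b" for i j
        using fg[OF that(1)] b[of j] bnd[OF that(1)] that(2) by (auto dest!: Bbnd)
      have inB: "(f i, g j) \<in> B" if "(i, j) \<in> P" "b \<le> j" for i j
        using fg[OF that(1)] b[of j] bnd[OF that(1)] that(2) by (auto dest!: Abnd)
      \<comment> \<open>If only the last column goes to \<open>B\<close>, then \<open>A\<close> is used completely and row \<open>q\<close> is forced to \<open>r\<close>.\<close>
      have "b \<le> k - 2"
      proof (rule ccontr)
        assume "\<not> b \<le> k - 2"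
        then have b1: "k - 1 \<le> b" by simp
        have gj: "g j = t + j" if "j < k - 1" for j
          by (rule strict_mono_prefix[of "k - 1"]) (use g b gbnd that b1 in \<open>auto\<close>)
        have fi: "f i = ra i" if i: "i < k" "i \<noteq> q" for i
        proof -
          obtain j where j: "(i, j) \<in> P" using perm_mat_row_ex[OF P] i by blast
          then have jk: "j < k - 1" using i lastcol by blast
          from inA[OF j] have "(f i, t + j) \<in> A" using jk b1 gj by simp
          then show ?thesis unfolding A_def using colu[OF j] by auto
        qed
        have "f q' < f q" "f q < f (q + 1)" using f q' qk by auto
        moreover have "f q' = s + q' + p'" "f (q + 1) = s + q' + p' + 2"
          using fi[of q'] fi[of "q + 1"] q' qk unfolding ra_def by auto
        ultimately have "f q = r" unfolding r_def p' by simp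
        then show False using fr qk by auto
      qed
      \<comment> \<open>The mirrored argument: if at most column 0 goes to \<open>A\<close>, then
        \<open>B\<close> is used completely and row \<open>p\<close> is forced to
        \<open>r\<close>.\<close>
      have "2 \<le> b"
      proof (rule ccontr)
        assume "\<not> 2 \<le> b"
        then have b1: "b \<le> 1" by simp
        have gj: "g (Suc j) = t + (k - 1) + j" if "j < k - 1" for j
        proof (rule strict_mono_prefix[of "k - 1"])
          show "t + (k - 1) \<le> g (Suc j) \<and> g (Suc j) < t + (k - 1) + (k - 1)" if "j < k - 1" for j
          proof -
            have "Suc j < k" using that by linarith
            then show ?thesis using b[of "Suc j"] gbnd[of "Suc j"] b1 by linarith
          qed
        qed (use g that in auto)
        have fi: "f i = rb i" if i: "i < k" "i \<noteq> p" for i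
        proof -
          obtain j where j: "(i, j) \<in> P" using perm_mat_row_ex[OF P] i by blast
          then obtain j' where j': "j = Suc j'" using i j colu[OF p] by (cases j) auto
          have j'k: "j' < k - 1" using bnd[OF j] j' by linarith
          have "g j = t + (k - 2) + j" using gj[OF j'k] k unfolding j' by linarith
          moreover have "(f i, g j) \<in> B" using inB[OF j] b1 j' by simp
          ultimately have "(f i, t + (k - 2) + j) \<in> B" by simp
          then show ?thesis unfolding B_def using colu[OF j] by auto
        qed
        have "f p' < f p" "f p < f (p + 1)" using f p' pk by auto
        moreover have "f p' = s + q' + p'" "f (p + 1) = s + q' + p' + 2"
          using fi[of p'] fi[of "p + 1"] p' pk unfolding rb_def by auto
        ultimately have "f p = r" unfolding r_def p' by simp
        then show False using fr pk by auto
      qed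
      \<comment> \<open>Outside the band there are only ones of \<open>A\<close>; this gives the
        empty block of the split.\<close>
      have outer: "j < b" if "(i, j) \<in> P" "i < a1 \<or> a2 \<le> i" for i j
      proof (rule ccontr)
        assume "\<not> j < b"
        then have "(f i, g j) \<in> B" using inB that by simp
        then have "s + q' \<le> f i \<and> f i < s + q' + k" by (auto dest!: Bbnd)
        then show False using a1(2)[of i] a2(2)[of i] that bnd by auto
      qed
      \<comment> \<open>\<open>A\<close> meets the band only in the three rows around
        \<open>r\<close>, and \<open>r\<close> itself is empty.\<close>
      have inner: "f i = r - 1 \<or> f i = r + 1" if "(i, j) \<in> P" "a1 \<le> i" "i < a2" "j < b" for i j
      proof -
        have "(f i, g j) \<in> A" using inA that by simp
        then obtain i' where "f i = ra i'" "i' < k" unfolding A_def by (auto dest: bnd)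
        moreover have "s + q' \<le> f i" "f i < s + q' + k" using a1(2)[of i] a2(2)[of i] that bnd by auto
        ultimately have "f i = s + (i' + p') \<and> q' \<le> i' \<and> i' \<le> q' + 2"
          unfolding ra_def by (auto split: if_splits)
        then show ?thesis using fr[of i] bnd[OF that(1)] unfolding r_def p' by auto
      qed
      have adj: "adjacent_rows (P \<inter> {a1..<a2} \<times> {..<b})"
        unfolding adjacent_rows_def
      proof (intro allI impI)
        fix i j i' j'
        assume *: "(i, j) \<in> P \<inter> {a1..<a2} \<times> {..<b}" "(i', j') \<in> P \<inter> {a1..<a2} \<times> {..<b}" "i < i'"
        then have i'k: "i' < k" using bnd by auto
        have "f i < f i'" using f * i'k by blast
        moreover have "f i = r - 1 \<or> f i = r + 1" "f i' = r - 1 \<or> f i' = r + 1"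
          using inner[of i j] inner[of i' j'] * by auto
        ultimately have fi: "f i = r - 1" "f i' = r + 1" by linarith+
        \<comment> \<open>A row strictly between would be sent strictly between \<open>r - 1\<close>
          and \<open>r + 1\<close>, that is to the empty row \<open>r\<close>.\<close>
        show "i' = Suc i"
        proof (rule ccontr)
          assume "i' \<noteq> Suc i"
          then have "f i < f (Suc i)" "f (Suc i) < f i'" using f * i'k by auto
          then show False using fr[of "Suc i"] fi * i'k by auto
        qed
      qed
      \<comment> \<open>Otherwise the \<open>k\<close> rows of the copy fill the band exactly, and
        row \<open>p\<close> falls on the empty row \<open>r\<close>.\<close>
      have "f 0 < s + q' \<or> s + q' + k \<le> f (k - 1)"
      proof (rule ccontr)
        assume "\<not> ?thesis"
        then have rng: "s + q' \<le> f i \<and> f i < s + q' + k" if "i < k" for i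
        proof -
          have "f 0 \<le> f i" using f[of 0 i] that by (cases "i = 0") auto
          moreover have "f i \<le> f (k - 1)"
          proof (cases "i = k - 1")
            case False
            then have "i < k - 1" using that by linarith
            then show ?thesis using f[of i "k - 1"] k by simp
          qed simp
          ultimately show ?thesis using \<open>\<not> (f 0 < s + q' \<or> s + q' + k \<le> f (k - 1))\<close> by linarith
        qed
        have "f p = s + q' + p" by (rule strict_mono_prefix[OF f rng]) (use pk in auto)
        then show False using fr[of p] pk unfolding r_def by simp
      qed
      then have out: "0 < a1 \<or> a2 < k" using a1 a2(2)[of "k - 1"] k by auto
      obtain i0 where i0: "(i0, k - 1) \<in> P" using q by blast
      \<comment> \<open>The one of the last column is in \<open>B\<close>, so its row goes into the
        band and the middle set of rows is nonempty.\<close>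
      have "a1 \<le> i0" "i0 < a2" using outer[OF i0] \<open>b \<le> k - 2\<close> k by force+
      then have a12: "a1 < a2" "a1 < k" using bnd[OF i0] by auto
      have bb: "0 < b" "b + 2 \<le> k" "b < k" using \<open>2 \<le> b\<close> \<open>b \<le> k - 2\<close> k by auto
      \<comment> \<open>Rows on both sides of the band give a Class 2 split, rows on one side only a
        Class 1 split, each up to reflection.\<close>
      show False
      proof (cases "0 < a1")
        case a1pos: True
        show False
        proof (cases "a2 < k")
          case True
          show False
            by (rule ordinary_no_split_middle[OF ord a1pos a12(1) True bb(1,2) _ adj])
              (erule (1) outer)
        next
          case False
          then have "adjacent_rows (P \<inter> {a1..<k} \<times> {..<b})" using adj a2(1) by simp
          then show False
            using ordinary_no_split_bottom[OF ord a1pos a12(2) bb(1,3)] outer by blast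
        qed
      next
        case False
        then have a2k: "a2 < k" and "0 < a2" and "adjacent_rows (P \<inter> {..<a2} \<times> {..<b})"
          using out a12 adj by (auto simp: lessThan_atLeast0)
        then show False
          using ordinary_no_split_top[OF ord _ a2k bb(1,3)] outer by blast
      qed
    qed
  qed
qed

section \<open>Expandable rows and columns bound the saturation function\<close>

text \<open>The block for \<open>P\<close> and the transposed block for \<open>flip_diag P\<close>
  sit on the diagonal. A copy meeting both would make \<open>P\<close> a direct sum, and neither
  block alone contains a copy.\<close>

lemma witness:
  assumes ord: "ordinary k P" and k: "2 \<le> k"
  obtains W r c where "W \<subseteq> {..<4 * k} \<times> {..<4 * k}" "r < 4 * k" "c < 4 * k"
    "\<not> occurs k P W" "\<And>y. occurs k P (insert (r, y) W)" "\<And>x. occurs k P (insert (x, c) W)"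
proof -
  note P = ordinary_perm[OF ord]
  obtain H r where H: "H \<subseteq> {0..<0 + 2 * k} \<times> {0..<0 + 2 * k}" "r < 0 + 2 * k"
    "\<not> occurs k P H" "\<And>y. occurs k P (insert (r, y) H)"
    using horizontal_witness[OF ord k, of 0 0] by metis
  obtain V c where V: "V \<subseteq> {2 * k..<2 * k + 2 * k} \<times> {2 * k..<2 * k + 2 * k}" "c < 2 * k + 2 * k"
    "\<not> occurs k (flip_diag P) V" "\<And>y. occurs k (flip_diag P) (insert (c, y) V)"
    using horizontal_witness[OF ordinary_flip_diag[OF ord] k, of "2 * k" "2 * k"] by metis
  define V' where "V' = flip_diag V"
  have tt: "flip_diag (flip_diag X) = X" for X by (auto simp: flip_diag_def)
  have V': "\<not> occurs k P V'" using V(3) occurs_flip_diag[of k P V'] tt unfolding V'_def by simp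
  have V'c: "occurs k P (insert (x, c) V')" for x
  proof -
    have "flip_diag (insert (x, c) V') = insert (c, x) V" unfolding V'_def flip_diag_def by auto
    then show ?thesis using V(4) occurs_flip_diag by metis
  qed
  show ?thesis
  proof (rule that[of "H \<union> V'" r c])
    show "H \<union> V' \<subseteq> {..<4 * k} \<times> {..<4 * k}" using H(1) V(1) unfolding V'_def flip_diag_def by force
    show "r < 4 * k" "c < 4 * k" using H(2) V(2) by auto
    show "occurs k P (insert (r, y) (H \<union> V'))" for y by (rule occurs_mono[OF H(4)[of y]]) auto
    show "occurs k P (insert (x, c) (H \<union> V'))" for x by (rule occurs_mono[OF V'c[of x]]) auto
    show "\<not> occurs k P (H \<union> V')"
    proof
      assume "occurs k P (H \<union> V')"
      then obtain f g where f: "\<And>i j. i < j \<Longrightarrow> j < k \<Longrightarrow> f i < f j"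
        and g: "\<And>i j. i < j \<Longrightarrow> j < k \<Longrightarrow> g i < g j"
        and fg: "\<And>i j. (i, j) \<in> P \<Longrightarrow> (f i, g j) \<in> H \<union> V'" by (rule occursE) blast
      obtain a where a: "a \<le> k" "\<And>i. i < k \<Longrightarrow> f i < 2 * k \<longleftrightarrow> i < a"
        using mono_threshold[of k f "2 * k"] f by blast
      obtain b where b: "b \<le> k" "\<And>i. i < k \<Longrightarrow> g i < 2 * k \<longleftrightarrow> i < b"
        using mono_threshold[of k g "2 * k"] g by blast
      \<comment> \<open>All ones lie in the two diagonal blocks, so the row cut and the column cut
        agree.\<close>
      have ab: "i < a \<longleftrightarrow> j < b" if "(i, j) \<in> P" for i j
        using fg[OF that] a(2)[of i] b(2)[of j] perm_mat_bound[OF P that] H(1) V(1)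
        unfolding V'_def flip_diag_def by fastforce
      have inH: "(f i, g j) \<in> H" if "(i, j) \<in> P" "i < a" for i j
        using fg[OF that(1)] a(2)[of i] perm_mat_bound[OF P that(1)] that(2) V(1)
        unfolding V'_def flip_diag_def by fastforce
      have inV: "(f i, g j) \<in> V'" if "(i, j) \<in> P" "\<not> i < a" for i j
        using fg[OF that(1)] a(2)[of i] perm_mat_bound[OF P that(1)] that(2) H(1) by fastforce
      have "0 < a" 
      proof (rule ccontr)
        assume "\<not> 0 < a"
        then show False using V' occursI[of k f g P V', OF f g inV] by auto
      qed
      moreover have "a < k"
      proof (rule ccontr)
        assume "\<not> a < k"
        then have "\<And>i j. (i, j) \<in> P \<Longrightarrow> i < a" using perm_mat_bound[OF P] by fastforce
        then show False using H(3) occursI[of k f g P H, OF f g inH] by auto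
      qed
      moreover have "0 < b" using ab perm_mat_row_ex[OF P, of 0] \<open>0 < a\<close> k by fastforce
      moreover have "b < k"
      proof -
        obtain j where j: "(a, j) \<in> P" using perm_mat_row_ex[OF P \<open>a < k\<close>] ..
        then show ?thesis using ab[OF j] perm_mat_bound[OF P j] by linarith
      qed
      ultimately show False using ordinary_no_sum[OF ord _ _ _ _ ab] by blast
    qed
  qed
qed

section \<open>Avoiding matrices and their saturating extensions\<close>

lemma saturating_extension:
  assumes P: "perm_mat k P" and A: "A \<subseteq> {..<n} \<times> {..<n}" "\<not> occurs k P A"
  obtains A' where "A \<subseteq> A'" "saturating n A' k P"
proof -
  define F where "F = {X. A \<subseteq> X \<and> X \<subseteq> {..<n} \<times> {..<n} \<and> \<not> occurs k P X}"
  have "finite F" unfolding F_def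
    by (rule finite_subset[of _ "Pow ({..<n} \<times> {..<n})"]) auto
  moreover have "A \<in> F" using A unfolding F_def by simp
  ultimately obtain X where X: "X \<in> F" "\<And>Y. Y \<in> F \<Longrightarrow> X \<subseteq> Y \<Longrightarrow> X = Y"
    using finite_has_maximal[of F] by blast
  have Xn: "A \<subseteq> X" "X \<subseteq> {..<n} \<times> {..<n}" "\<not> occurs k P X" using X(1) unfolding F_def by auto
  have "contains n n (insert x X) k k P" if x: "x \<in> {..<n} \<times> {..<n} - X" for x
  proof -
    have "insert x X \<subseteq> {..<n} \<times> {..<n}" using x Xn by auto
    moreover have "insert x X \<notin> F" using X(2)[of "insert x X"] x by auto
    ultimately show ?thesis using contains_iff_occurs[OF P] Xn unfolding F_def by auto
  qed
  then have "saturating n X k P" unfolding saturating_def using contains_iff_occurs[OF P] Xn by auto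
  then show ?thesis using that Xn by blast
qed

lemma sat_le: "saturating n A k P \<Longrightarrow> sat n k P \<le> card A"
  unfolding sat_def by (rule Least_le) blast

lemma saturating_card: "saturating n A k P \<Longrightarrow> card A \<le> n * n"
  using card_mono[of "{..<n} \<times> {..<n}" A] by (simp add: saturating_def card_cartesian_product)

lemma saturating_not_occurs: "perm_mat k P \<Longrightarrow> saturating n A k P \<Longrightarrow> \<not> occurs k P A"
  using contains_iff_occurs unfolding saturating_def by blast

text \<open>Collapses the indices \<open>r\<close> to \<open>r + d\<close> to \<open>r\<close>.
  Pulling a matrix back along it repeats row or column \<open>r\<close> another \<open>d\<close>
  times.\<close>

definition squeeze :: "nat \<Rightarrow> nat \<Rightarrow> nat \<Rightarrow> nat" where
  "squeeze r d i = (if i < r then i else if i \<le> r + d then r else i - d)"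

lemma squeeze_mono: "i \<le> j \<Longrightarrow> squeeze r d i \<le> squeeze r d j"
  by (auto simp: squeeze_def)

lemma squeeze_inj: "squeeze r d i = squeeze r d j \<Longrightarrow> squeeze r d i \<noteq> r \<Longrightarrow> i = j"
  by (auto simp: squeeze_def split: if_splits)

lemma squeeze_bound: "r < N \<Longrightarrow> squeeze r d i < N \<longleftrightarrow> i < N + d"
  by (auto simp: squeeze_def)

text \<open>A right inverse of a monotone map is strictly increasing; this one is chosen to pass
  through the prescribed point \<open>x\<close>.\<close>

lemma squeeze_section:
  obtains u where "u (squeeze r d x) = x" "\<And>v. squeeze r d (u v) = v" "\<And>v w. v < w \<Longrightarrow> u v < u w"
proof -
  define u where "u v = (if v = squeeze r d x then x else if v \<le> r then v else v + d)" for v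
  have s: "squeeze r d (u v) = v" for v unfolding u_def squeeze_def by auto
  have "u v < u w" if "v < w" for v w
    using squeeze_mono[of "u w" "u v" r d] that s by (metis not_le)
  then show ?thesis using that[of u] s unfolding u_def by auto
qed

lemma bounded_of_witness:
  assumes P: "perm_mat k P"
    and W: "W \<subseteq> {..<N} \<times> {..<N}" and r: "r < N" and c: "c < N" and av: "\<not> occurs k P W"
    and row: "\<And>y. occurs k P (insert (r, y) W)" and col: "\<And>x. occurs k P (insert (x, c) W)"
  shows "sat (N + d) k P \<le> N * N"
proof -
  let ?h = "squeeze r d" and ?l = "squeeze c d" and ?n = "N + d"
  define M where "M = {(i, j). (?h i, ?l j) \<in> W}"
  \<comment> \<open>A one of \<open>W\<close> in row \<open>r\<close> would make the insertion
    trivial, and \<open>W\<close> itself would contain \<open>P\<close>.\<close>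
  have Wr: "(r, y) \<notin> W" for y using row[of y] av by (auto simp: insert_absorb)
  have Wc: "(x, c) \<notin> W" for x using col[of x] av by (auto simp: insert_absorb)
  have "i < ?n \<and> j < ?n" if "(i, j) \<in> M" for i j
    using that W squeeze_bound[OF r, of d i] squeeze_bound[OF c, of d j] unfolding M_def by auto
  then have Mn: "M \<subseteq> {..<?n} \<times> {..<?n}" by auto
  have "\<not> occurs k P M"
  proof
    assume "occurs k P M"
    then obtain f g where f: "\<And>i j. i < j \<Longrightarrow> j < k \<Longrightarrow> f i < f j"
      and g: "\<And>i j. i < j \<Longrightarrow> j < k \<Longrightarrow> g i < g j"
      and fg: "\<And>i j. (i, j) \<in> P \<Longrightarrow> (f i, g j) \<in> M" by (rule occursE) blast
    have "occurs k P W"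
    proof (rule occursI[of k "\<lambda>i. ?h (f i)" "\<lambda>j. ?l (g j)"])
      fix i j :: nat assume ij: "i < j" "j < k"
      \<comment> \<open>Each row of the copy holds a one and so avoids the empty row
        \<open>r\<close>, the only value at which \<open>?h\<close> can fail to be
        injective.\<close>
      have "?h (f i) \<noteq> r" using perm_mat_row_ex[OF P, of i] fg Wr ij unfolding M_def by fastforce
      then show "?h (f i) < ?h (f j)"
        using f[OF ij] squeeze_mono[of "f i" "f j" r d] squeeze_inj[of r d "f i" "f j"] by fastforce
      have "?l (g i) \<noteq> c" using perm_mat_col_ex[OF P, of i] fg Wc ij unfolding M_def by fastforce
      then show "?l (g i) < ?l (g j)"
        using g[OF ij] squeeze_mono[of "g i" "g j" c d] squeeze_inj[of c d "g i" "g j"] by fastforce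
    qed (use fg in \<open>auto simp: M_def\<close>)
    then show False using av by blast
  qed
  then obtain X where X: "M \<subseteq> X" "saturating ?n X k P" by (rule saturating_extension[OF P Mn])
  note Xav = saturating_not_occurs[OF P X(2)]
  \<comment> \<open>The right inverses send the added one back to \<open>(x, y)\<close> itself and
    not to another repeated position.\<close>
  have lift: "occurs k P (insert (x, y) M)" if occ: "occurs k P (insert (?h x, ?l y) W)" for x y
  proof -
    obtain f g where f: "\<And>i j. i < j \<Longrightarrow> j < k \<Longrightarrow> f i < f j"
      and g: "\<And>i j. i < j \<Longrightarrow> j < k \<Longrightarrow> g i < g j"
      and fg: "\<And>i j. (i, j) \<in> P \<Longrightarrow> (f i, g j) \<in> insert (?h x, ?l y) W"
      using occ by (rule occursE) blast
    obtain u where u: "u (?h x) = x" "\<And>v. ?h (u v) = v" "\<And>v w. v < w \<Longrightarrow> u v < u w"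
      using squeeze_section by metis
    obtain w where w: "w (?l y) = y" "\<And>v. ?l (w v) = v" "\<And>v v'. v < v' \<Longrightarrow> w v < w v'"
      using squeeze_section by metis
    show ?thesis
      by (rule occursI[of k "\<lambda>i. u (f i)" "\<lambda>j. w (g j)"])
        (use f g u w fg in \<open>fastforce simp: M_def\<close>)+
  qed
  have notr: "?h i \<noteq> r \<and> ?l j \<noteq> c" if "(i, j) \<in> X" for i j
  proof (rule ccontr)
    assume "\<not> ?thesis"
    then have "occurs k P (insert (i, j) M)" using lift row col by metis
    then show False using Xav occurs_mono[of k P _ X] X(1) that by blast
  qed
  \<comment> \<open>Off the repeated rows and columns nothing is collapsed, so \<open>X\<close> has
    at most as many ones as an \<open>N\<close> by \<open>N\<close> matrix has entries.\<close>
  have "inj_on (map_prod ?h ?l) X"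
    using notr squeeze_inj by (fastforce simp: inj_on_def)
  moreover have "map_prod ?h ?l ` X \<subseteq> {..<N} \<times> {..<N}"
    using X(2) squeeze_bound[OF r] squeeze_bound[OF c] unfolding saturating_def by fastforce
  ultimately have "card X \<le> card ({..<N} \<times> {..<N})" by (rule card_inj_on_le) simp
  then show ?thesis using sat_le[OF X(2)] by (simp add: card_cartesian_product)
qed

text \<open>A crude bound for the small sizes. Starting from the empty matrix shows that the
  \<open>LEAST\<close> in \<open>sat\<close> is attained.\<close>

lemma sat_le_square:
  assumes "perm_mat k P" "0 < k"
  shows "sat n k P \<le> n * n"
proof -
  have "\<not> occurs k P {}" using perm_mat_row_ex[OF assms] by (auto elim: occursE)
  then obtain X where "saturating n X k P" using saturating_extension[OF assms(1), of "{}" n] by blast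
  then show ?thesis using sat_le saturating_card le_trans by blast
qed

theorem theorem2:
  fixes k :: nat and P :: "(nat \<times> nat) set"
  assumes "ordinary k P"
  shows "\<exists>c::nat. \<forall>n. sat n k P \<le> c"
proof -
  note P = ordinary_perm[OF assms]
  consider "k = 0" | "k = 1" | "2 \<le> k" by linarith
  then show ?thesis
  proof cases
    case 1
    \<comment> \<open>The empty pattern occurs everywhere, so \<open>sat\<close> is a junk value independent of \<open>n\<close>.\<close>
    have "\<not> saturating n A k P" for n A
      using P 1 unfolding saturating_def contains_def perm_mat_def by auto
    then have "sat n k P = (LEAST c. False)" for n unfolding sat_def by simp
    then show ?thesis by auto
  next
    case 2
    have "sat n k P = 0" for n
    proof -
      have "\<not> occurs k P {}" using perm_mat_row_ex[OF P, of 0] 2 by (auto elim: occursE)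
      then obtain X where X: "saturating n X k P" using saturating_extension[OF P, of "{}" n] by blast
      \<comment> \<open>A single one occurs in every nonempty matrix, so only the empty matrix is
        saturating.\<close>
      have "P = {(0, 0)}" using P 2 unfolding perm_mat_def by auto
      then have "occurs k P X" if "x \<in> X" for x
        using that 2 by (intro occursI[of k "\<lambda>_. fst x" "\<lambda>_. snd x"]) auto
      then have "X = {}" using saturating_not_occurs[OF P X] by blast
      then show ?thesis using sat_le[OF X] by simp
    qed
    then show ?thesis by auto
  next
    case 3
    obtain W r c where W: "W \<subseteq> {..<4 * k} \<times> {..<4 * k}" "r < 4 * k" "c < 4 * k"
      "\<not> occurs k P W" "\<And>y. occurs k P (insert (r, y) W)" "\<And>x. occurs k P (insert (x, c) W)"
      using witness[OF assms 3] by metis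
    have "sat n k P \<le> 4 * k * (4 * k)" for n
    proof (cases "n < 4 * k")
      case True
      have "sat n k P \<le> n * n" using sat_le_square[OF P] 3 by simp
      also have "\<dots> \<le> 4 * k * (4 * k)" using True by (intro mult_le_mono) auto
      finally show ?thesis .
    next
      case False
      then show ?thesis using bounded_of_witness[OF P W, of "n - 4 * k"] by simp
    qed
    then show ?thesis by blast
  qed
qed

end
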